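(* Let $G$ be a torsion-free group and $\mathbb{F}$ a field with the property that there exists a positive integer $k$ such that $\mathbb{F}[G]$ has no non-zero element $\alpha$ with $|supp(\alpha)|\leq k$ and $\alpha^2=0$. Then there exist no non-zero elements $\alpha_1,\alpha_2\in\mathbb{F}[G]$ such that $\alpha_1\alpha_2=0$ and $|supp(\alpha_1)|\,|supp(\alpha_2)|\leq k$ (for that same $k$).
   Context: For $\alpha=\sum_{x\in G}a_xx\in\mathbb{F}[G]$, $supp(\alpha)=\{x\in G: a_x\neq 0\}$. *)

theory Defs
  imports Main "HOL-Library.Poly_Mapping"
begin

text \<open>
  A group \<open>G\<close> is a type \<open>'g\<close> of class \<^class>\<open>group_add\<close>. Despite the additive notation, that class
  does not require commutativity, so \<open>x + y\<close> stands for the product \<open>xy\<close> and \<open>0\<close> for the identity.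
  The group algebra \<open>F[G]\<close> is \<open>'g \<Rightarrow>\<^sub>0 'f\<close>, the finitely supported functions \<open>G \<rightarrow> F\<close>: its
  multiplication in \<^theory>\<open>HOL-Library.Poly_Mapping\<close> is the convolution
  \<open>(\<alpha>\<beta>)(z) = \<Sum>{\<alpha>(x)\<beta>(y) | z = x + y}\<close>, and \<open>Poly_Mapping.keys \<alpha>\<close> is the support of \<open>\<alpha>\<close>.
\<close>

text \<open>Here \<open>((+) g ^^ n) 0\<close> is the \<open>n\<close>-th power of \<open>g\<close> in the group.\<close>

definition torsion_free :: "'g::group_add itself \<Rightarrow> bool" where
  "torsion_free _ \<longleftrightarrow> (\<forall>g::'g. g \<noteq> 0 \<longrightarrow> (\<forall>n>0. ((+) g ^^ n) 0 \<noteq> 0))"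

end

theory Submission
  imports Defs "HOL-Algebra.Generated_Groups" "HOL-Algebra.FiniteProduct"
begin

text \<open>
  If \<open>\<alpha>\<^sub>1 \<alpha>\<^sub>2 = 0\<close>, then \<open>(\<alpha>\<^sub>2 x \<alpha>\<^sub>1)\<^sup>2 = 0\<close> for every group element \<open>x\<close>, and the support of
  \<open>\<alpha>\<^sub>2 x \<alpha>\<^sub>1\<close> has at most \<open>|supp \<alpha>\<^sub>1| |supp \<alpha>\<^sub>2|\<close> elements, so it is enough that some \<open>\<alpha>\<^sub>2 x \<alpha>\<^sub>1\<close> is
  non-zero, which is Connell's theorem that the group ring is prime. Here it comes from a
  combinatorial fact: for finite non-empty \<open>A\<close>, \<open>B\<close> there is an \<open>x\<close> such that \<open>A x B\<close> contains an
  element with only one representation \<open>a x b\<close>. By Neumann's separation lemma \<open>x\<close> can be chosen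
  such that \<open>a x b = a' x b'\<close> forces \<open>a\<^sup>-\<^sup>1 a'\<close> and \<open>b b'\<^sup>-\<^sup>1\<close> into the FC-center (the elements
  with finitely many conjugates). In a torsion-free group the FC-center is abelian, by Schur's
  transfer argument, and torsion-free abelian groups have unique products since they can be
  ordered.
\<close>

section \<open>The transfer homomorphism\<close>

context group
begin

text \<open>Counterpart of \<open>torsion_free\<close> for groups with a carrier: the argument later
  treats the FC-center as a group in its own right, and that is a set rather than a type.\<close>

definition torsion_free_group :: bool where
  "torsion_free_group \<longleftrightarrow> (\<forall>g\<in>carrier G. \<forall>n::nat. n > 0 \<longrightarrow> g [^] n = \<one> \<longrightarrow> g = \<one>)"

text \<open>The labels \<open>\<kappa> h\<close> stand for the cosets \<open>h Z\<close>.\<close>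

lemma transfer_hom:
  fixes \<kappa> :: "'a \<Rightarrow> 'k"
  assumes H: "subgroup H G" and Z: "subgroup Z G" and "Z \<subseteq> H"
    and central: "\<And>z h. z \<in> Z \<Longrightarrow> h \<in> H \<Longrightarrow> z \<otimes> h = h \<otimes> z"
    and fin: "finite (\<kappa> ` H)"
    and \<kappa>: "\<And>g h. g \<in> H \<Longrightarrow> h \<in> H \<Longrightarrow> \<kappa> g = \<kappa> h \<longleftrightarrow> inv g \<otimes> h \<in> Z"
  obtains V :: "'a \<Rightarrow> 'a" and n :: nat where "n > 0" "V \<in> hom (G\<lparr>carrier := H\<rparr>) (G\<lparr>carrier := Z\<rparr>)"
    "\<And>z. z \<in> Z \<Longrightarrow> V z = z [^] n"
proof -
  interpret H: subgroup H G by (rule H)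
  interpret Z: subgroup Z G by (rule Z)
  interpret ZG: comm_group "G\<lparr>carrier := Z\<rparr>"
    using subgroup_imp_group[OF Z] central \<open>Z \<subseteq> H\<close>
    by (intro group.group_comm_groupI) auto
  note [simp] = m_assoc
  \<comment> \<open>\<open>\<rho>\<close> picks one representative of each coset h Z in H, so the
    set \<open>T\<close> below is a transversal.\<close>
  define \<rho> where "\<rho> h = inv_into H \<kappa> (\<kappa> h)" for h
  have \<rho>_in: "\<rho> h \<in> H" and \<kappa>\<rho>: "\<kappa> (\<rho> h) = \<kappa> h" if "h \<in> H" for h
    unfolding \<rho>_def using that by (auto intro: inv_into_into f_inv_into_f)
  have \<rho>_eq: "\<rho> g = \<rho> h \<longleftrightarrow> inv g \<otimes> h \<in> Z" if "g \<in> H" "h \<in> H" for g h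
    using \<kappa>\<rho> that \<kappa> by (metis \<rho>_def)
  define T where "T = \<rho> ` H"
  have T_sub: "T \<subseteq> H" using \<rho>_in by (auto simp: T_def)
  have T_\<rho>: "\<rho> t = t" if "t \<in> T" for t
    using that \<kappa>\<rho> by (auto simp: T_def) (metis \<rho>_def)
  have "T = inv_into H \<kappa> ` \<kappa> ` H" by (auto simp: T_def \<rho>_def)
  then have finT: "finite T" using fin by simp
  have neT: "T \<noteq> {}" using H.one_closed unfolding T_def by blast
  \<comment> \<open>\<open>f g t\<close> is the Z-part of g t: the product g t equals
    \<open>\<rho> (g \<otimes> t)\<close> times \<open>f g t\<close>.\<close>
  define f where "f g t = inv (\<rho> (g \<otimes> t)) \<otimes> (g \<otimes> t)" for g t
  have f_in: "f g t \<in> Z" if "g \<in> H" "t \<in> H" for g t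
    unfolding f_def using \<rho>_in \<kappa>\<rho> \<kappa> that by (metis H.m_closed)
  have \<rho>_shift: "\<rho> (g \<otimes> \<rho> h) = \<rho> (g \<otimes> h)" if "g \<in> H" "h \<in> H" for g h
  proof -
    have "inv (\<rho> h) \<otimes> h \<in> Z" using \<rho>_in \<kappa>\<rho> \<kappa> that by metis
    moreover have "inv (g \<otimes> \<rho> h) \<otimes> (g \<otimes> h) = inv (\<rho> h) \<otimes> h"
      using that \<rho>_in[of h] by (simp add: inv_mult_group inv_solve_left)
        (simp add: m_assoc[symmetric])
    ultimately show ?thesis using \<rho>_eq \<rho>_in that by (metis H.m_closed)
  qed
  \<comment> \<open>Write h t = r z with r the representative and z = \<open>f h t\<close>. Then g h
    t = (g r) z, and g r has Z-part \<open>f g r\<close>.\<close>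
  have cocycle: "f (g \<otimes> h) t = f g (\<rho> (h \<otimes> t)) \<otimes> f h t" if "g \<in> H" "h \<in> H" "t \<in> H" for g h t
  proof -
    let ?r = "\<rho> (h \<otimes> t)"
    have "?r \<in> carrier G" "\<rho> (g \<otimes> (h \<otimes> t)) \<in> carrier G"
      using \<rho>_in that by auto
    moreover have "?r \<otimes> (inv ?r \<otimes> (h \<otimes> t)) = h \<otimes> t"
      using calculation that by (simp add: m_assoc[symmetric] del: m_assoc)
    ultimately show ?thesis
      unfolding f_def using that \<rho>_shift[of g "h \<otimes> t"] by simp
  qed
  \<comment> \<open>Left multiplication by h permutes the cosets of Z, hence the
    transversal.\<close>
  have bij: "bij_betw (\<lambda>t. \<rho> (h \<otimes> t)) T T" if h: "h \<in> H" for h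
  proof -
    have "inj_on (\<lambda>t. \<rho> (h \<otimes> t)) T"
    proof (rule inj_onI)
      fix s t assume st: "s \<in> T" "t \<in> T" "\<rho> (h \<otimes> s) = \<rho> (h \<otimes> t)"
      then have sH: "s \<in> H" "t \<in> H" using T_sub by auto
      with st h have "inv (h \<otimes> s) \<otimes> (h \<otimes> t) \<in> Z" using \<rho>_eq by auto
      moreover have "inv (h \<otimes> s) \<otimes> (h \<otimes> t) = inv s \<otimes> t"
        using h sH by (simp add: inv_mult_group) (simp add: m_assoc[symmetric] del: m_assoc)
      ultimately have "\<rho> s = \<rho> t" using \<rho>_eq sH by simp
      then show "s = t" using st T_\<rho> by simp
    qed
    moreover have "(\<lambda>t. \<rho> (h \<otimes> t)) ` T \<subseteq> T" using h T_sub by (auto simp: T_def)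
    ultimately show ?thesis
      using finT by (simp add: bij_betw_def endo_inj_surj)
  qed
  \<comment> \<open>The product of the Z-parts is formed in the abelian group Z, so the order of the
    factors is immaterial.\<close>
  define V where "V h = finprod (G\<lparr>carrier := Z\<rparr>) (f h) T" for h
  have fT: "f h \<in> T \<rightarrow> carrier (G\<lparr>carrier := Z\<rparr>)" if "h \<in> H" for h
    using f_in T_sub that by auto
  have V_in: "V h \<in> Z" if "h \<in> H" for h
    using ZG.finprod_closed[OF fT[OF that]] by (simp add: V_def)
  \<comment> \<open>The cocycle identity splits the product in two, and the permutation of
    \<open>T\<close> induced by h turns the first part into \<open>V g\<close>.\<close>
  have V_mult: "V (g \<otimes> h) = V g \<otimes> V h" if gh: "g \<in> H" "h \<in> H" for g h
  proof -
    let ?s = "\<lambda>t. \<rho> (h \<otimes> t)"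
    have sT: "?s ` T = T" "inj_on ?s T" using bij[OF gh(2)] by (auto simp: bij_betw_def)
    have fs: "(\<lambda>t. f g (?s t)) \<in> T \<rightarrow> carrier (G\<lparr>carrier := Z\<rparr>)"
      using fT[OF gh(1)] sT by auto
    have "V (g \<otimes> h) = finprod (G\<lparr>carrier := Z\<rparr>) (\<lambda>t. f g (?s t) \<otimes>\<^bsub>G\<lparr>carrier := Z\<rparr>\<^esub> f h t) T"
      unfolding V_def using cocycle gh T_sub fs fT[OF gh(2)]
      by (intro ZG.finprod_cong') (auto simp: Pi_iff)
    also have "\<dots> = finprod (G\<lparr>carrier := Z\<rparr>) (\<lambda>t. f g (?s t)) T \<otimes> V h"
      using ZG.finprod_multf[OF fs fT[OF gh(2)]] by (simp add: V_def)
    also have "finprod (G\<lparr>carrier := Z\<rparr>) (\<lambda>t. f g (?s t)) T = V g"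
      using ZG.finprod_reindex[of "f g" ?s T] fT[OF gh(1)] sT by (simp add: V_def)
    finally show ?thesis .
  qed
  \<comment> \<open>Since z is central in H, z t = t z has representative t and Z-part z, so all
    \<open>card T\<close> factors equal z.\<close>
  have V_pow: "V z = z [^] card T" if z: "z \<in> Z" for z
  proof -
    have "f z t = z" if t: "t \<in> T" for t
    proof -
      have tH: "t \<in> H" "t \<in> carrier G" using t T_sub by auto
      have zt: "z \<otimes> t = t \<otimes> z" using central[OF z tH(1)] .
      have "inv t \<otimes> (z \<otimes> t) = z"
        unfolding zt using z tH by (simp add: m_assoc[symmetric] del: m_assoc)
      moreover have "\<rho> (z \<otimes> t) = \<rho> t"
        using \<rho>_eq[of t "z \<otimes> t"] calculation z tH \<open>Z \<subseteq> H\<close> by auto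
      ultimately show ?thesis using T_\<rho>[OF t] by (simp add: f_def)
    qed
    then have "V z = finprod (G\<lparr>carrier := Z\<rparr>) (\<lambda>_. z) T"
      unfolding V_def using z by (intro ZG.finprod_cong') auto
    also have "\<dots> = z [^]\<^bsub>G\<lparr>carrier := Z\<rparr>\<^esub> card T"
      using ZG.finprod_const[of z T] z by simp
    finally show ?thesis by (simp add: nat_pow_consistent[symmetric])
  qed
  show thesis
    by (rule that[of "card T" V])
      (use finT neT V_in V_mult V_pow in \<open>auto simp: hom_def card_gt_0_iff\<close>)
qed

section \<open>Elements with finitely many conjugates\<close>

definition fc_center :: "'a set" where
  "fc_center = {x \<in> carrier G. finite ((\<lambda>g. g \<otimes> x \<otimes> inv g) ` carrier G)}"

lemma fc_center_conj:
  assumes "x \<in> fc_center" "h \<in> carrier G"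
  shows "h \<otimes> x \<otimes> inv h \<in> fc_center"
proof -
  have "(\<lambda>g. g \<otimes> (h \<otimes> x \<otimes> inv h) \<otimes> inv g) ` carrier G \<subseteq> (\<lambda>g. g \<otimes> x \<otimes> inv g) ` carrier G"
  proof (rule image_subsetI)
    fix g assume "g \<in> carrier G"
    then have "g \<otimes> (h \<otimes> x \<otimes> inv h) \<otimes> inv g = (g \<otimes> h) \<otimes> x \<otimes> inv (g \<otimes> h)" "g \<otimes> h \<in> carrier G"
      using assms by (auto simp: fc_center_def m_assoc inv_mult_group)
    then show "g \<otimes> (h \<otimes> x \<otimes> inv h) \<otimes> inv g \<in> (\<lambda>g. g \<otimes> x \<otimes> inv g) ` carrier G"
      by blast
  qed
  then show ?thesis
    using assms by (auto simp: fc_center_def intro: finite_subset)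
qed

lemma conj_inv_conj:
  assumes "h \<in> carrier G" "x \<in> carrier G"
  shows "inv h \<otimes> (h \<otimes> x \<otimes> inv h) \<otimes> h = x"
  using assms by (simp add: m_assoc) (simp add: m_assoc[symmetric])

lemma fc_center_conj_iff:
  assumes "x \<in> carrier G" "h \<in> carrier G"
  shows "h \<otimes> x \<otimes> inv h \<in> fc_center \<longleftrightarrow> x \<in> fc_center"
  using fc_center_conj[of x h] fc_center_conj[of "h \<otimes> x \<otimes> inv h" "inv h"]
    conj_inv_conj[of h x] assms by auto

text \<open>Conjugation by g is an automorphism: the class of an inverse is the image of the class
  under inversion, and the class of a product lies in the product of two finite classes.\<close>

lemma fc_center_subgroup: "subgroup fc_center G"
proof (rule subgroupI)
  show "fc_center \<subseteq> carrier G" by (auto simp: fc_center_def)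
  have "\<one> \<in> fc_center" by (simp add: fc_center_def) (rule finite_subset[of _ "{\<one>}"], auto)
  then show "fc_center \<noteq> {}" by auto
next
  fix x assume x: "x \<in> fc_center"
  have "g \<otimes> inv x \<otimes> inv g = inv (g \<otimes> x \<otimes> inv g)" if "g \<in> carrier G" for g
    using that x by (simp add: fc_center_def inv_mult_group m_assoc)
  then have "(\<lambda>g. g \<otimes> inv x \<otimes> inv g) ` carrier G = m_inv G ` (\<lambda>g. g \<otimes> x \<otimes> inv g) ` carrier G"
    by (simp add: image_image)
  then show "inv x \<in> fc_center" using x by (simp add: fc_center_def)
next
  fix x y assume xy: "x \<in> fc_center" "y \<in> fc_center"
  have "g \<otimes> (x \<otimes> y) \<otimes> inv g = (g \<otimes> x \<otimes> inv g) \<otimes> (g \<otimes> y \<otimes> inv g)" if "g \<in> carrier G" for g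
  proof -
    have "inv g \<otimes> (g \<otimes> (y \<otimes> inv g)) = y \<otimes> inv g"
      using that xy by (simp add: fc_center_def m_assoc[symmetric])
    then show ?thesis using that xy by (simp add: fc_center_def m_assoc)
  qed
  then have "(\<lambda>g. g \<otimes> (x \<otimes> y) \<otimes> inv g) ` carrier G \<subseteq>
      (\<lambda>(a, b). a \<otimes> b) ` ((\<lambda>g. g \<otimes> x \<otimes> inv g) ` carrier G \<times> (\<lambda>g. g \<otimes> y \<otimes> inv g) ` carrier G)"
    by force
  then have "finite ((\<lambda>g. g \<otimes> (x \<otimes> y) \<otimes> inv g) ` carrier G)"
    by (rule finite_subset) (use xy in \<open>simp add: fc_center_def\<close>)
  then show "x \<otimes> y \<in> fc_center"
    using xy by (simp add: fc_center_def)
qed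

section \<open>Centralizers and commutativity of the FC-center\<close>

lemma commute_inv:
  assumes "x \<in> carrier G" "y \<in> carrier G" "x \<otimes> y = y \<otimes> x"
  shows "x \<otimes> inv y = inv y \<otimes> x"
proof -
  have "inv y \<otimes> (x \<otimes> y) \<otimes> inv y = inv y \<otimes> (y \<otimes> x) \<otimes> inv y"
    using assms by simp
  then have "inv y \<otimes> (x \<otimes> (y \<otimes> inv y)) = (inv y \<otimes> y) \<otimes> (x \<otimes> inv y)"
    using assms(1,2) by (simp only: m_assoc inv_closed m_closed)
  then show ?thesis using assms(1,2) by simp
qed

lemma commute_mult:
  assumes "x \<in> carrier G" "y \<in> carrier G" "z \<in> carrier G"
    and "x \<otimes> z = z \<otimes> x" "y \<otimes> z = z \<otimes> y"
  shows "(x \<otimes> y) \<otimes> z = z \<otimes> (x \<otimes> y)"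
  using assms by (metis m_assoc)

text \<open>The centralizer of \<open>z\<close> is a subgroup, so it contains whatever
  \<open>S\<close> generates.\<close>

lemma commute_generate:
  assumes "z \<in> carrier G" "S \<subseteq> carrier G" "\<And>s. s \<in> S \<Longrightarrow> z \<otimes> s = s \<otimes> z"
    and "h \<in> generate G S"
  shows "z \<otimes> h = h \<otimes> z"
  using assms(4)
proof (induction rule: generate.induct)
  case (inv h)
  then show ?case using assms(1-3) commute_inv by blast
next
  case (eng h1 h2)
  have "h1 \<in> carrier G" "h2 \<in> carrier G"
    using eng.hyps generate_in_carrier[OF assms(2)] by auto
  then show ?case using eng.IH commute_mult[of h1 h2 z] assms(1) by simp
qed (use assms in auto)

text \<open>Orbit-stabilizer: conjugates of \<open>x\<close> correspond to left cosets of its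
  centralizer. This supplies the coset labels for the transfer.\<close>

lemma conj_eq_iff:
  assumes "g \<in> carrier G" "h \<in> carrier G" "x \<in> carrier G"
  shows "g \<otimes> x \<otimes> inv g = h \<otimes> x \<otimes> inv h \<longleftrightarrow> (inv g \<otimes> h) \<otimes> x = x \<otimes> (inv g \<otimes> h)"
proof
  assume eq: "g \<otimes> x \<otimes> inv g = h \<otimes> x \<otimes> inv h"
  have "(inv g \<otimes> h) \<otimes> x = inv g \<otimes> (h \<otimes> x \<otimes> inv h) \<otimes> h"
    using assms by (simp add: m_assoc)
  also have "\<dots> = inv g \<otimes> (g \<otimes> x \<otimes> inv g) \<otimes> h" by (simp add: eq)
  also have "\<dots> = (inv g \<otimes> g) \<otimes> (x \<otimes> (inv g \<otimes> h))"
    using assms by (simp only: m_assoc inv_closed m_closed)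
  finally show "(inv g \<otimes> h) \<otimes> x = x \<otimes> (inv g \<otimes> h)" using assms by simp
next
  assume eq: "(inv g \<otimes> h) \<otimes> x = x \<otimes> (inv g \<otimes> h)"
  have "h \<otimes> x \<otimes> inv h = (g \<otimes> inv g) \<otimes> h \<otimes> x \<otimes> inv h" using assms by simp
  also have "\<dots> = g \<otimes> ((inv g \<otimes> h) \<otimes> x) \<otimes> inv h"
    using assms by (simp only: m_assoc inv_closed m_closed)
  also have "\<dots> = g \<otimes> (x \<otimes> (inv g \<otimes> h)) \<otimes> inv h" by (simp only: eq)
  also have "\<dots> = g \<otimes> x \<otimes> inv g" using assms by (simp add: m_assoc)
  finally show "g \<otimes> x \<otimes> inv g = h \<otimes> x \<otimes> inv h" by simp
qed

text \<open>For the subgroup generated by two elements of the FC-center, the center has finite index,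
  and the transfer into it has trivial kernel because every kernel element is torsion.\<close>

lemma fc_center_commute:
  assumes tf: torsion_free_group and xy: "x \<in> fc_center" "y \<in> fc_center"
  shows "x \<otimes> y = y \<otimes> x"
proof -
  have xyG [simp]: "x \<in> carrier G" "y \<in> carrier G" using xy by (auto simp: fc_center_def)
  define H where "H = generate G {x, y}"
  define Z where "Z = {z \<in> H. z \<otimes> x = x \<otimes> z \<and> z \<otimes> y = y \<otimes> z}"
  \<comment> \<open>The pair of conjugates of the two generators labels the coset of h modulo the
    center \<open>Z\<close> of \<open>H\<close>. Finite classes leave finitely many labels, so
    \<open>Z\<close> has finite index.\<close>
  define \<kappa> where "\<kappa> h = (h \<otimes> x \<otimes> inv h, h \<otimes> y \<otimes> inv h)" for h
  have H: "subgroup H G" unfolding H_def by (rule generate_is_subgroup) simp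
  interpret H: subgroup H G by (rule H)
  have Z: "subgroup Z G"
  proof (rule subgroupI)
    show "Z \<subseteq> carrier G" "Z \<noteq> {}"
      using H.one_closed by (auto simp: Z_def intro!: exI[of _ \<one>])
    show "inv a \<in> Z" if "a \<in> Z" for a
      using that commute_inv[of x a] commute_inv[of y a] by (simp add: Z_def)
    show "a \<otimes> b \<in> Z" if "a \<in> Z" "b \<in> Z" for a b
      using that commute_mult[of a b x] commute_mult[of a b y] by (simp add: Z_def)
  qed
  have ZH: "Z \<subseteq> H" by (auto simp: Z_def)
  have central: "z \<otimes> h = h \<otimes> z" if "z \<in> Z" "h \<in> H" for z h
    using that commute_generate[of z "{x, y}" h] by (auto simp: Z_def H_def[symmetric])
  have "\<kappa> ` H \<subseteq> (\<lambda>g. g \<otimes> x \<otimes> inv g) ` carrier G \<times> (\<lambda>g. g \<otimes> y \<otimes> inv g) ` carrier G"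
    by (auto simp: \<kappa>_def)
  then have fin: "finite (\<kappa> ` H)"
    by (rule finite_subset) (use xy in \<open>simp add: fc_center_def\<close>)
  have \<kappa>: "\<kappa> g = \<kappa> h \<longleftrightarrow> inv g \<otimes> h \<in> Z" if "g \<in> H" "h \<in> H" for g h
    using that by (simp add: \<kappa>_def conj_eq_iff Z_def)
  obtain V :: "'a \<Rightarrow> 'a" and n :: nat where n: "n > 0"
    and V: "V \<in> hom (G\<lparr>carrier := H\<rparr>) (G\<lparr>carrier := Z\<rparr>)"
    and Vn: "\<And>z. z \<in> Z \<Longrightarrow> V z = z [^] n"
    using transfer_hom[OF H Z ZH central fin \<kappa>] by blast
  have V_in: "V h \<in> Z" if "h \<in> H" for h using V that by (auto simp: hom_def)
  have V_mult: "V (g \<otimes> h) = V g \<otimes> V h" if "g \<in> H" "h \<in> H" for g h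
    using V that by (auto simp: hom_def)
  have xyH: "x \<in> H" "y \<in> H" by (auto simp: H_def intro: generate.incl)
  \<comment> \<open>\<open>d\<close> is a commutator of x and y; as \<open>V\<close> maps into an
    abelian group, it sends \<open>d\<close> to the identity.\<close>
  define d where "d = inv (x \<otimes> y) \<otimes> (y \<otimes> x)"
  have dH: "d \<in> H" using xyH by (simp add: d_def)
  have xyd: "(x \<otimes> y) \<otimes> d = y \<otimes> x"
    using xyG by (simp only: d_def m_assoc[symmetric] m_closed inv_closed r_inv l_one)
  have "V (x \<otimes> y) \<otimes> V d = V (y \<otimes> x)" using V_mult[of "x \<otimes> y" d] xyH dH xyd by simp
  also have "V (y \<otimes> x) = V (x \<otimes> y)"
    using V_mult xyH V_in central[of "V x" "V y"] subsetD[OF ZH V_in[of y]] by auto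
  finally have "V (x \<otimes> y) \<otimes> V d = V (x \<otimes> y) \<otimes> \<one>"
    using V_in[of "x \<otimes> y"] xyH subgroup.mem_carrier[OF Z] by simp
  moreover have "V (x \<otimes> y) \<in> carrier G" "V d \<in> carrier G"
    using V_in[of "x \<otimes> y"] V_in[OF dH] xyH subgroup.mem_carrier[OF Z] by auto
  ultimately have Vd: "V d = \<one>" by (metis inv_closed l_inv l_one m_assoc one_closed)
  have d_pow: "d [^] i \<in> H" for i :: nat
    by (induction i) (use dH in auto)
  have V_d_pow: "V (d [^] (Suc i)) = \<one>" for i :: nat
  proof (induction i)
    case (Suc i)
    have "V (d [^] (Suc (Suc i))) = V (d [^] (Suc i)) \<otimes> V d"
      using V_mult[OF d_pow[of "Suc i"] dH] by simp
    then show ?case by (simp only: Suc Vd l_one one_closed)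
  qed (use dH Vd in simp)
  \<comment> \<open>Pigeonhole: the powers of \<open>d\<close> meet only finitely many cosets of
    \<open>Z\<close>, so two of them share a coset and a positive power lies in
    \<open>Z\<close>.\<close>
  have "\<not> inj (\<lambda>i::nat. \<kappa> (d [^] i))"
  proof
    assume "inj (\<lambda>i::nat. \<kappa> (d [^] i))"
    moreover have "finite (range (\<lambda>i::nat. \<kappa> (d [^] i)))"
      by (rule finite_subset[OF _ fin]) (use d_pow in blast)
    ultimately show False using finite_imageD infinite_UNIV_nat by blast
  qed
  then obtain i j :: nat where ij: "i < j" "\<kappa> (d [^] i) = \<kappa> (d [^] j)"
    unfolding inj_def by (metis linorder_neqE_nat)
  have "inv (d [^] i) \<otimes> d [^] j = d [^] (j - i)"
  proof -
    have "d [^] j = d [^] i \<otimes> d [^] (j - i)" using dH ij(1) by (simp add: nat_pow_mult)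
    then show ?thesis using dH by (simp add: m_assoc[symmetric])
  qed
  then have dZ: "d [^] (j - i) \<in> Z" using \<kappa>[OF d_pow d_pow] ij(2) by metis
  \<comment> \<open>\<open>V\<close> kills positive powers of \<open>d\<close>, yet acts on
    \<open>Z\<close> as the n-th power map. Hence \<open>d\<close> is torsion.\<close>
  have "V (d [^] (j - i)) = \<one>" using V_d_pow ij(1) by (metis Suc_diff_Suc)
  then have "d [^] ((j - i) * n) = \<one>" using Vn[OF dZ] dH by (simp add: nat_pow_pow)
  moreover have "(j - i) * n > 0" using n ij(1) by simp
  ultimately have "d = \<one>" using tf H.mem_carrier[OF dH] unfolding torsion_free_group_def by blast
  then show ?thesis using xyd by simp
qed

text \<open>B. H. Neumann's separation lemma, for the conjugation action.\<close>

lemma conjugate_away: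
  assumes "finite C" "C \<subseteq> carrier G - fc_center" "finite F"
  shows "\<exists>g\<in>carrier G. \<forall>c\<in>C. g \<otimes> c \<otimes> inv g \<notin> F"
  using assms
proof (induction C arbitrary: F rule: finite_induct)
  case empty
  then show ?case by auto
next
  case (insert c C)
  \<comment> \<open>The class of an element outside the FC-center is infinite and cannot fit into
    \<open>F\<close>. The implication makes the claim hold for every b, so that \<open>k\<close> can
    be chosen as a function.\<close>
  have "\<exists>k\<in>carrier G. b \<in> carrier G - fc_center \<longrightarrow> k \<otimes> b \<otimes> inv k \<notin> F" for b
  proof (cases "b \<in> carrier G - fc_center")
    case True
    then have "\<not> (\<lambda>g. g \<otimes> b \<otimes> inv g) ` carrier G \<subseteq> F"
      using insert.prems(2) finite_subset by (auto simp: fc_center_def)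
    then show ?thesis by auto
  qed auto
  then obtain k where k: "\<And>b. k b \<in> carrier G"
    "\<And>b. b \<in> carrier G - fc_center \<Longrightarrow> k b \<otimes> b \<otimes> inv (k b) \<notin> F"
    by metis
  \<comment> \<open>The g from the induction may still send \<open>c\<close> to some b in
    \<open>F\<close>; then \<open>k b \<otimes> g\<close> is used instead. Avoiding also the
    preimages of \<open>F\<close> under conjugation by each \<open>k b\<close> ensures that this
    correction does not move \<open>C\<close> into \<open>F\<close>.\<close>
  let ?F' = "F \<union> (\<Union>b\<in>F. (\<lambda>f. inv (k b) \<otimes> f \<otimes> k b) ` F)"
  obtain g where g: "g \<in> carrier G" "\<And>c. c \<in> C \<Longrightarrow> g \<otimes> c \<otimes> inv g \<notin> ?F'"
    using insert.IH[of ?F'] insert.prems by auto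
  define b where "b = g \<otimes> c \<otimes> inv g"
  show ?case
  proof (cases "b \<in> F")
    case False
    then show ?thesis using g by (auto simp: b_def)
  next
    case True
    have b: "b \<in> carrier G - fc_center"
      using insert.prems g fc_center_conj_iff[of c g] by (auto simp: b_def)
    have conj: "(k b \<otimes> g) \<otimes> x \<otimes> inv (k b \<otimes> g) = k b \<otimes> (g \<otimes> x \<otimes> inv g) \<otimes> inv (k b)"
      if "x \<in> carrier G" for x
      using that k(1) g(1) by (simp add: m_assoc inv_mult_group)
    have "(k b \<otimes> g) \<otimes> x \<otimes> inv (k b \<otimes> g) \<notin> F" if x: "x \<in> C" for x
    proof
      have xG: "x \<in> carrier G" using x insert.prems by auto
      assume "(k b \<otimes> g) \<otimes> x \<otimes> inv (k b \<otimes> g) \<in> F"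
      then have "g \<otimes> x \<otimes> inv g \<in> (\<lambda>f. inv (k b) \<otimes> f \<otimes> k b) ` F"
        using conj_inv_conj[of "k b" "g \<otimes> x \<otimes> inv g"] conj[OF xG] k(1) g(1) xG
        by (intro image_eqI[where x = "(k b \<otimes> g) \<otimes> x \<otimes> inv (k b \<otimes> g)"]) auto
      then show False using g(2)[OF x] True by blast
    qed
    moreover have "(k b \<otimes> g) \<otimes> c \<otimes> inv (k b \<otimes> g) \<notin> F"
      using conj[of c] k(2)[OF b] insert.prems by (simp add: b_def)
    ultimately show ?thesis
      using k(1) g(1) by (intro bexI[of _ "k b \<otimes> g"]) auto
  qed
qed

end

section \<open>Unique products in torsion-free abelian groups\<close>

text \<open>The non-negative elements of a partial order in which x is below y when
  \<open>inv x \<otimes> y \<in> P\<close>. Closure under roots, the last clause, is what lets the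
  cone be enlarged by a new element.\<close>

definition (in group) isolated_cone :: "'a set \<Rightarrow> bool" where
  "isolated_cone P \<longleftrightarrow> P \<subseteq> carrier G \<and> \<one> \<in> P \<and> (\<forall>x\<in>P. \<forall>y\<in>P. x \<otimes> y \<in> P) \<and>
     (\<forall>x\<in>P. inv x \<in> P \<longrightarrow> x = \<one>) \<and>
     (\<forall>x\<in>carrier G. \<forall>n::nat. n > 0 \<longrightarrow> x [^] n \<in> P \<longrightarrow> x \<in> P)"

lemma (in group) isolated_cone_pow:
  assumes "isolated_cone P" "x \<in> P"
  shows "x [^] (n::nat) \<in> P"
  by (induction n) (use assms in \<open>auto simp: isolated_cone_def\<close>)

context comm_group
begin

text \<open>The new cone consists of all roots of elements of the monoid generated by
  \<open>P\<close> and \<open>c\<close>. It stays antisymmetric: if x and its inverse both lie in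
  it, a power of \<open>inv c\<close> lies in \<open>P\<close>, and since \<open>inv c\<close>
  itself does not, the exponent is zero.\<close>

lemma extend_isolated_cone:
  assumes P: "isolated_cone P" and c: "c \<in> carrier G" and c_notin: "inv c \<notin> P"
  obtains Q where "isolated_cone Q" "P \<subseteq> Q" "c \<in> Q"
proof -
  have PG: "P \<subseteq> carrier G" and P1: "\<one> \<in> P" and Pm: "\<And>x y. x \<in> P \<Longrightarrow> y \<in> P \<Longrightarrow> x \<otimes> y \<in> P"
    and Pinv: "\<And>x. x \<in> P \<Longrightarrow> inv x \<in> P \<Longrightarrow> x = \<one>"
    and Pi: "\<And>x n. x \<in> carrier G \<Longrightarrow> (n::nat) > 0 \<Longrightarrow> x [^] n \<in> P \<Longrightarrow> x \<in> P"
    using P by (auto simp: isolated_cone_def)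
  note Pp = isolated_cone_pow[OF P]
  define Q where "Q = {x \<in> carrier G. \<exists>n::nat. \<exists>m::nat. \<exists>p\<in>P. n > 0 \<and> x [^] n = p \<otimes> c [^] m}"
  have scale: "x [^] (n * k) = p [^] k \<otimes> c [^] (m * k)"
    if "x \<in> carrier G" "p \<in> P" "x [^] n = p \<otimes> c [^] m" for x p and n m k :: nat
  proof -
    have "x [^] (n * k) = (p \<otimes> c [^] m) [^] k" using that by (simp add: nat_pow_pow[symmetric])
    then show ?thesis using that PG c by (simp add: nat_pow_distrib nat_pow_pow subset_iff)
  qed
  \<comment> \<open>Raising both relations to the common exponent \<open>n * k\<close> allows them
    to be multiplied.\<close>
  have combine: "(x \<otimes> y) [^] (n * k) = (p [^] k \<otimes> q [^] n) \<otimes> c [^] (m * k + l * n)"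
    if "x \<in> carrier G" "y \<in> carrier G" "p \<in> P" "q \<in> P"
      "x [^] n = p \<otimes> c [^] m" "y [^] k = q \<otimes> c [^] l" for x y p q and n m k l :: nat
  proof -
    have "(x \<otimes> y) [^] (n * k) = x [^] (n * k) \<otimes> y [^] (k * n)"
      using that by (simp add: nat_pow_distrib mult.commute)
    also have "\<dots> = (p [^] k \<otimes> c [^] (m * k)) \<otimes> (q [^] n \<otimes> c [^] (l * n))"
      using scale[of x p n m k] scale[of y q k l n] that by simp
    also have "\<dots> = (p [^] k \<otimes> q [^] n) \<otimes> (c [^] (m * k) \<otimes> c [^] (l * n))"
    proof -
      have "p \<in> carrier G" "q \<in> carrier G" using that PG by auto
      then show ?thesis using c by (simp add: m_ac)
    qed
    finally show ?thesis using c by (simp add: nat_pow_mult)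
  qed
  have "isolated_cone Q"
    unfolding isolated_cone_def
  proof (intro conjI ballI allI impI)
    show "Q \<subseteq> carrier G" by (auto simp: Q_def)
    have "\<one> [^] (1::nat) = \<one> \<otimes> c [^] (0::nat)" by simp
    then show "\<one> \<in> Q" using P1 unfolding Q_def by blast
  next
    fix x y assume "x \<in> Q" "y \<in> Q"
    then obtain n m k l :: nat and p q where *: "x \<in> carrier G" "y \<in> carrier G" "p \<in> P" "q \<in> P"
      "x [^] n = p \<otimes> c [^] m" "y [^] k = q \<otimes> c [^] l" "n > 0" "k > 0"
      unfolding Q_def by blast
    then have "p [^] k \<otimes> q [^] n \<in> P" "n * k > 0" using Pm Pp by auto
    then show "x \<otimes> y \<in> Q"
      using combine[OF *(1-6)] *(1,2) unfolding Q_def by blast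
  next
    fix x assume "x \<in> Q" "inv x \<in> Q"
    then obtain n m k l :: nat and p q where *: "x \<in> carrier G" "inv x \<in> carrier G" "p \<in> P" "q \<in> P"
      "x [^] n = p \<otimes> c [^] m" "inv x [^] k = q \<otimes> c [^] l" "n > 0" "k > 0"
      unfolding Q_def by blast
    let ?M = "m * k + l * n" and ?p = "p [^] k \<otimes> q [^] n"
    have pP: "?p \<in> P" using * Pm Pp by auto
    then have pG: "?p \<in> carrier G" using PG by auto
    \<comment> \<open>The relations for x and its inverse are combined, so the left-hand power is a
      power of the identity.\<close>
    have "?p \<otimes> c [^] ?M = \<one>" using combine[OF *(1-6)] *(1) by simp
    then have "inv (c [^] ?M) = ?p" using pG c by (metis inv_equality nat_pow_closed)
    then have "inv c [^] ?M \<in> P" using pP c by (simp add: nat_pow_inv)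
    then have "?M = 0" using Pi[of "inv c" ?M] c c_notin by blast
    then have "m = 0" "l = 0" using * by auto
    then have "x [^] n \<in> P" "inv x [^] k \<in> P" using * PG by auto
    then show "x = \<one>" using Pi Pinv * by blast
  next
    fix x and r :: nat assume x: "x \<in> carrier G" "r > 0" "x [^] r \<in> Q"
    then obtain n m :: nat and p where "p \<in> P" "n > 0" "(x [^] r) [^] n = p \<otimes> c [^] m"
      unfolding Q_def by blast
    then have "x [^] (r * n) = p \<otimes> c [^] m" "r * n > 0" using x by (auto simp: nat_pow_pow)
    then show "x \<in> Q" using x \<open>p \<in> P\<close> unfolding Q_def by blast
  qed
  moreover have "x \<in> Q" if "x \<in> P" for x
  proof -
    have "x [^] (1::nat) = x \<otimes> c [^] (0::nat)" using that PG by auto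
    then show ?thesis using that PG unfolding Q_def by blast
  qed
  moreover have "c [^] (1::nat) = \<one> \<otimes> c [^] (1::nat)" using c by simp
  then have "c \<in> Q" using P1 c unfolding Q_def by blast
  ultimately show thesis using that by blast
qed

text \<open>Only finitely many elements have to be made comparable with the identity, so finite
  induction suffices in place of a maximality argument. The trivial cone to start from is closed
  under roots by torsion-freeness.\<close>

lemma exists_isolated_cone:
  assumes torsion_free_group "finite C" "C \<subseteq> carrier G"
  shows "\<exists>P. isolated_cone P \<and> (\<forall>c\<in>C. c \<in> P \<or> inv c \<in> P)"
  using assms(2,3)
proof (induction rule: finite_induct)
  case empty
  have "isolated_cone {\<one>}"
    using assms(1) by (auto simp: isolated_cone_def torsion_free_group_def)
  then show ?case by auto
next
  case (insert c C)
  then obtain P where P: "isolated_cone P" "\<forall>c\<in>C. c \<in> P \<or> inv c \<in> P" by auto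
  show ?case
  proof (cases "inv c \<in> P")
    case True
    then show ?thesis using P by auto
  next
    case False
    then obtain Q where "isolated_cone Q" "P \<subseteq> Q" "c \<in> Q"
      using extend_isolated_cone[OF P(1)] insert.prems by blast
    then show ?thesis using P(2) by blast
  qed
qed

text \<open>A finite chain has a maximum; transitivity of the order is closure of \<open>P\<close>
  under products.\<close>

lemma cone_greatest:
  assumes P: "isolated_cone P" and A: "finite A" "A \<noteq> {}" "A \<subseteq> carrier G"
    and total: "\<And>a b. a \<in> A \<Longrightarrow> b \<in> A \<Longrightarrow> inv a \<otimes> b \<in> P \<or> inv (inv a \<otimes> b) \<in> P"
  shows "\<exists>a\<in>A. \<forall>b\<in>A. inv b \<otimes> a \<in> P"
  using A total
proof (induction rule: finite_ne_induct)
  case (singleton x)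
  then show ?case using P by (auto simp: isolated_cone_def)
next
  case (insert x A)
  have sub: "x \<in> carrier G" "A \<subseteq> carrier G" using insert.prems(1) by auto
  obtain a where a: "a \<in> A" "\<forall>b\<in>A. inv b \<otimes> a \<in> P" using insert by auto
  then have aG: "a \<in> carrier G" using sub by auto
  have one: "\<one> \<in> P" using P by (simp add: isolated_cone_def)
  have "inv x \<otimes> a \<in> P \<or> inv (inv x \<otimes> a) \<in> P" using insert.prems(2) a(1) by auto
  then show ?case
  proof
    assume "inv x \<otimes> a \<in> P"
    then show ?thesis using a by auto
  next
    assume "inv (inv x \<otimes> a) \<in> P"
    then have ax: "inv a \<otimes> x \<in> P" using sub aG by (simp add: inv_mult_group)
    have "inv b \<otimes> x \<in> P" if "b \<in> A" for b
    proof -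
      have "(inv b \<otimes> a) \<otimes> (inv a \<otimes> x) \<in> P" using P a(2) ax that by (auto simp: isolated_cone_def)
      moreover have "a \<otimes> (inv a \<otimes> x) = x" using aG sub by (simp add: m_assoc[symmetric])
      moreover have "b \<in> carrier G" using that sub by auto
      ultimately show ?thesis using aG sub by (simp add: m_assoc)
    qed
    then show ?thesis using sub one by auto
  qed
qed

text \<open>The product of the two maxima has a single factorization: in any other, both quotients
  would be non-negative and inverse to each other, hence trivial.\<close>

lemma unique_product:
  assumes tf: torsion_free_group
    and A: "finite A" "A \<noteq> {}" "A \<subseteq> carrier G" and B: "finite B" "B \<noteq> {}" "B \<subseteq> carrier G"
  shows "\<exists>a\<in>A. \<exists>b\<in>B. \<forall>a'\<in>A. \<forall>b'\<in>B. a' \<otimes> b' = a \<otimes> b \<longrightarrow> a' = a \<and> b' = b"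
proof -
  \<comment> \<open>All quotients within \<open>A\<close> and within \<open>B\<close>; a cone
    deciding these orders both sets totally.\<close>
  define C where "C = (\<lambda>(a, b). inv a \<otimes> b) ` (A \<times> A \<union> B \<times> B)"
  have "finite C" "C \<subseteq> carrier G" using A B by (auto simp: C_def subset_iff)
  then obtain P where P: "isolated_cone P" "\<forall>c\<in>C. c \<in> P \<or> inv c \<in> P"
    using exists_isolated_cone[OF tf] by blast
  obtain a where a: "a \<in> A" "\<forall>a'\<in>A. inv a' \<otimes> a \<in> P"
    using cone_greatest[OF P(1) A] P(2) unfolding C_def by fast
  obtain b where b: "b \<in> B" "\<forall>b'\<in>B. inv b' \<otimes> b \<in> P"
    using cone_greatest[OF P(1) B] P(2) unfolding C_def by fast
  have "a' = a \<and> b' = b" if "a' \<in> A" "b' \<in> B" and eq: "a' \<otimes> b' = a \<otimes> b" for a' b'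
  proof -
    have G: "a \<in> carrier G" "b \<in> carrier G" "a' \<in> carrier G" "b' \<in> carrier G"
      using A B a(1) b(1) that by auto
    have "(inv a' \<otimes> a) \<otimes> (inv b' \<otimes> b) = inv (a' \<otimes> b') \<otimes> (a \<otimes> b)"
      using G by (simp add: inv_mult m_ac)
    also have "\<dots> = \<one>" using G eq by simp
    finally have "inv (inv a' \<otimes> a) = inv b' \<otimes> b"
      using G by (metis inv_closed m_closed inv_equality m_comm)
    then have "inv a' \<otimes> a = \<one>" using a(2) b(2) that P(1) by (auto simp: isolated_cone_def)
    then have "a' = a" using G by (metis inv_closed inv_equality inv_inv)
    then show ?thesis using eq G by simp
  qed
  then show ?thesis using a(1) b(1) by blast
qed

end

section \<open>Primeness of the group ring\<close>

text \<open>The witness is \<open>inv g\<close>, where g separates quotients of \<open>A\<close>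
  outside the FC-center from quotients of \<open>B\<close>. A collision with a suitable pair then
  stays inside the FC-center, where unique products are available.\<close>

lemma (in group) unique_product_twisted:
  assumes tf: torsion_free_group
    and A: "finite A" "A \<noteq> {}" "A \<subseteq> carrier G" and B: "finite B" "B \<noteq> {}" "B \<subseteq> carrier G"
  shows "\<exists>x\<in>carrier G. \<exists>a\<in>A. \<exists>b\<in>B. \<forall>a'\<in>A. \<forall>b'\<in>B.
           a' \<otimes> x \<otimes> b' = a \<otimes> x \<otimes> b \<longrightarrow> a' = a \<and> b' = b"
proof -
  let ?D = fc_center
  interpret D: subgroup ?D G by (rule fc_center_subgroup)
  interpret DG: comm_group "G\<lparr>carrier := ?D\<rparr>"
    using subgroup_imp_group[OF fc_center_subgroup] fc_center_commute[OF tf]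
    by (intro group.group_comm_groupI) auto
  have DG_tf: "DG.torsion_free_group"
    using tf by (auto simp: torsion_free_group_def DG.torsion_free_group_def
        nat_pow_consistent[symmetric])
  obtain a0 b0 where 0: "a0 \<in> A" "b0 \<in> B" using A B by auto
  have AG [simp]: "a \<in> carrier G" if "a \<in> A" for a using A that by auto
  have BG [simp]: "b \<in> carrier G" if "b \<in> B" for b using B that by auto
  note [simp] = 0
  define C where "C = (\<lambda>(a, a'). inv a \<otimes> a') ` (A \<times> A) - ?D"
  define F where "F = (\<lambda>(b, b'). b \<otimes> inv b') ` (B \<times> B)"
  have "finite C" "C \<subseteq> carrier G - ?D" "finite F"
    using A B by (auto simp: C_def F_def)
  then obtain g where g [simp]: "g \<in> carrier G" and gC: "\<forall>c\<in>C. g \<otimes> c \<otimes> inv g \<notin> F"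
    using conjugate_away by blast
  \<comment> \<open>These normalizations turn \<open>a \<otimes> inv g \<otimes> b\<close> into
    \<open>\<phi> a \<otimes> \<psi> b\<close> up to fixed outer factors. They send a0 and b0 to the
    identity, so \<open>A'\<close> and \<open>B'\<close> are non-empty.\<close>
  define \<phi> where "\<phi> a = g \<otimes> (inv a0 \<otimes> a) \<otimes> inv g" for a
  define \<psi> where "\<psi> b = b \<otimes> inv b0" for b
  define A' where "A' = {a \<in> A. \<phi> a \<in> ?D}"
  define B' where "B' = {b \<in> B. \<psi> b \<in> ?D}"
  have "\<phi> a0 = \<one>" "\<psi> b0 = \<one>" by (simp_all add: \<phi>_def \<psi>_def)
  then have "a0 \<in> A'" "b0 \<in> B'" by (simp_all add: A'_def B'_def)
  then have "\<phi> ` A' \<noteq> {}" "\<psi> ` B' \<noteq> {}" by auto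
  moreover have "finite (\<phi> ` A')" "finite (\<psi> ` B')" using A B by (auto simp: A'_def B'_def)
  moreover have "\<phi> ` A' \<subseteq> ?D" "\<psi> ` B' \<subseteq> ?D" by (auto simp: A'_def B'_def)
  ultimately obtain a b where ab: "a \<in> A'" "b \<in> B'"
    and uniq: "\<forall>a'\<in>A'. \<forall>b'\<in>B'. \<phi> a' \<otimes> \<psi> b' = \<phi> a \<otimes> \<psi> b \<longrightarrow> \<phi> a' = \<phi> a \<and> \<psi> b' = \<psi> b"
    using DG.unique_product[OF DG_tf, of "\<phi> ` A'" "\<psi> ` B'"] by auto
  have abin [simp]: "a \<in> A" "b \<in> B" using ab by (auto simp: A'_def B'_def)
  have \<phi>G [simp]: "\<phi> a \<in> carrier G" if "a \<in> A" for a using that by (simp add: \<phi>_def)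
  have \<psi>G [simp]: "\<psi> b \<in> carrier G" if "b \<in> B" for b using that by (simp add: \<psi>_def)
  have prod: "a' \<otimes> inv g \<otimes> b' = a0 \<otimes> inv g \<otimes> (\<phi> a' \<otimes> \<psi> b') \<otimes> b0" if "a' \<in> A" "b' \<in> B" for a' b'
  proof -
    have "a0 \<otimes> inv g \<otimes> (\<phi> a' \<otimes> \<psi> b') \<otimes> b0 =
        a0 \<otimes> ((inv g \<otimes> g) \<otimes> (inv a0 \<otimes> (a' \<otimes> (inv g \<otimes> (b' \<otimes> (inv b0 \<otimes> b0))))))"
      using that by (simp only: \<phi>_def \<psi>_def m_assoc m_closed inv_closed AG BG 0 g)
    then show ?thesis using that by (simp add: m_assoc[symmetric])
  qed
  have "a' = a \<and> b' = b"
    if in': "a' \<in> A" "b' \<in> B" and eq: "a' \<otimes> inv g \<otimes> b' = a \<otimes> inv g \<otimes> b" for a' b'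
  proof -
    have eq': "\<phi> a' \<otimes> \<psi> b' = \<phi> a \<otimes> \<psi> b"
      using eq prod in' by simp
    \<comment> \<open>The left quotient is the conjugate by g of \<open>inv a \<otimes> a'\<close>,
      the right one is \<open>b \<otimes> inv b'\<close>, an element of \<open>F\<close>. The choice
      of g therefore puts \<open>inv a \<otimes> a'\<close> in the FC-center.\<close>
    have quot: "inv (\<phi> a) \<otimes> \<phi> a' = \<psi> b \<otimes> inv (\<psi> b')"
    proof -
      have "inv (\<phi> a) \<otimes> (\<phi> a' \<otimes> \<psi> b') \<otimes> inv (\<psi> b') = inv (\<phi> a) \<otimes> (\<phi> a \<otimes> \<psi> b) \<otimes> inv (\<psi> b')"
        by (simp only: eq')
      then have "(inv (\<phi> a) \<otimes> \<phi> a') \<otimes> (\<psi> b' \<otimes> inv (\<psi> b')) =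
          (inv (\<phi> a) \<otimes> \<phi> a) \<otimes> (\<psi> b \<otimes> inv (\<psi> b'))"
        using in' by (simp only: m_assoc m_closed inv_closed \<phi>G \<psi>G abin)
      then show ?thesis using in' by simp
    qed
    have \<psi>_quot: "\<psi> b \<otimes> inv (\<psi> b') = b \<otimes> inv b'"
    proof -
      have "\<psi> b \<otimes> inv (\<psi> b') = b \<otimes> ((inv b0 \<otimes> b0) \<otimes> inv b')"
        using in' by (simp only: \<psi>_def inv_mult_group inv_inv m_assoc m_closed inv_closed
              BG 0 abin)
      then show ?thesis using in' by simp
    qed
    have \<phi>_quot: "inv (\<phi> a) \<otimes> \<phi> a' = g \<otimes> (inv a \<otimes> a') \<otimes> inv g"
    proof -
      have "inv (\<phi> a) \<otimes> \<phi> a' =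
          g \<otimes> (inv a \<otimes> (a0 \<otimes> ((inv g \<otimes> g) \<otimes> (inv a0 \<otimes> (a' \<otimes> inv g)))))"
        using in' by (simp only: \<phi>_def inv_mult_group inv_inv m_assoc m_closed inv_closed
              AG 0 g abin)
      then show ?thesis using in' by (simp add: m_assoc[symmetric])
    qed
    have "g \<otimes> (inv a \<otimes> a') \<otimes> inv g \<in> F"
      using quot \<phi>_quot \<psi>_quot in' by (auto simp: F_def)
    then have "inv a \<otimes> a' \<notin> C" using gC by blast
    then have "inv a \<otimes> a' \<in> ?D"
      using in' by (auto simp: C_def)
    then have qD: "inv (\<phi> a) \<otimes> \<phi> a' \<in> ?D"
      using \<phi>_quot fc_center_conj by simp
    \<comment> \<open>With the quotient in the FC-center, membership passes from
      \<open>\<phi> a\<close> and \<open>\<psi> b\<close> to \<open>\<phi> a'\<close> and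
      \<open>\<psi> b'\<close>, so uniqueness over \<open>A'\<close> and \<open>B'\<close>
      applies.\<close>
    have "\<phi> a \<in> ?D" "\<psi> b \<in> ?D" using ab by (auto simp: A'_def B'_def)
    then have "\<phi> a \<otimes> (inv (\<phi> a) \<otimes> \<phi> a') \<in> ?D" "inv (inv (\<phi> a) \<otimes> \<phi> a') \<otimes> \<psi> b \<in> ?D"
      using qD by auto
    moreover have "\<phi> a \<otimes> (inv (\<phi> a) \<otimes> \<phi> a') = \<phi> a'"
      using in' by (simp add: m_assoc[symmetric])
    moreover have "inv (inv (\<phi> a) \<otimes> \<phi> a') \<otimes> \<psi> b = \<psi> b'"
      unfolding quot using in' by (simp add: inv_mult_group m_assoc)
    ultimately have "a' \<in> A'" "b' \<in> B'" using in' by (auto simp: A'_def B'_def)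
    then have "\<phi> a' = \<phi> a" "\<psi> b' = \<psi> b" using uniq eq' by auto
    then show ?thesis using in' by (simp add: \<phi>_def \<psi>_def)
  qed
  then show ?thesis using abin g by (metis inv_closed)
qed

section \<open>From groups with a carrier to the group ring over a type\<close>

definition additive_group :: "'g::group_add monoid" where
  "additive_group = \<lparr>carrier = UNIV, monoid.mult = (+), one = 0\<rparr>"

lemma group_additive_group: "group (additive_group :: 'g::group_add monoid)"
  by (rule groupI) (auto simp: additive_group_def add.assoc intro: left_minus)

lemma additive_group_pow:
  "x [^]\<^bsub>additive_group\<^esub> n = ((+) x ^^ n) (0 :: 'g::group_add)"
proof (induction n)
  case (Suc n)
  interpret group "additive_group :: 'g monoid" by (rule group_additive_group)
  show ?case
    using Suc nat_pow_Suc2[of x n] by (simp add: additive_group_def)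
qed (simp add: additive_group_def)

lemma torsion_free_additive_group:
  assumes "torsion_free TYPE('g::group_add)"
  shows "group.torsion_free_group (additive_group :: 'g monoid)"
proof -
  interpret group "additive_group :: 'g monoid" by (rule group_additive_group)
  show ?thesis
    using assms by (auto simp: torsion_free_group_def torsion_free_def additive_group_pow)
      (auto simp: additive_group_def)
qed

text \<open>Terms outside the supports vanish, which reduces the convolution to an ordinary finite
  sum.\<close>

lemma lookup_mult_keys:
  fixes \<alpha> \<beta> :: "'g::monoid_add \<Rightarrow>\<^sub>0 'f::semiring_0"
  shows "Poly_Mapping.lookup (\<alpha> * \<beta>) z =
    (\<Sum>(a, b)\<in>Poly_Mapping.keys \<alpha> \<times> Poly_Mapping.keys \<beta>.
      Poly_Mapping.lookup \<alpha> a * Poly_Mapping.lookup \<beta> b when z = a + b)"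
proof -
  have "Poly_Mapping.lookup (\<alpha> * \<beta>) z =
      (\<Sum>(a, b). Poly_Mapping.lookup \<alpha> a * Poly_Mapping.lookup \<beta> b when z = a + b)"
    unfolding times_poly_mapping.rep_eq by (rule prod_fun_unfold_prod) simp_all
  also have "\<dots> =
    (\<Sum>(a, b)\<in>Poly_Mapping.keys \<alpha> \<times> Poly_Mapping.keys \<beta>.
      Poly_Mapping.lookup \<alpha> a * Poly_Mapping.lookup \<beta> b when z = a + b)"
    by (rule Sum_any.expand_superset) (auto simp: in_keys_iff)
  finally show ?thesis .
qed

text \<open>At a uniquely represented element a x b, the coefficient is one product of two non-zero
  coefficients, hence non-zero in the absence of zero divisors.\<close>

lemma group_ring_prime:
  fixes \<alpha> \<beta> :: "'g::group_add \<Rightarrow>\<^sub>0 'f::{semiring_1_no_zero_divisors}"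
  assumes "torsion_free TYPE('g)" "\<alpha> \<noteq> 0" "\<beta> \<noteq> 0"
  shows "\<exists>x. \<alpha> * Poly_Mapping.single x 1 * \<beta> \<noteq> 0"
proof -
  interpret group "additive_group :: 'g monoid" by (rule group_additive_group)
  obtain x a b where ab: "a \<in> Poly_Mapping.keys \<alpha>" "b \<in> Poly_Mapping.keys \<beta>"
    and uniq: "\<And>a' b'. a' \<in> Poly_Mapping.keys \<alpha> \<Longrightarrow> b' \<in> Poly_Mapping.keys \<beta> \<Longrightarrow>
      a' + x + b' = a + x + b \<Longrightarrow> a' = a \<and> b' = b"
    using unique_product_twisted[OF torsion_free_additive_group[OF assms(1)],
        of "Poly_Mapping.keys \<alpha>" "Poly_Mapping.keys \<beta>"] assms(2,3)
    by (simp add: additive_group_def) metis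
  \<comment> \<open>Right multiplication by the group element x only translates the
    coefficients.\<close>
  have shift: "Poly_Mapping.lookup (\<alpha> * Poly_Mapping.single x 1) (c + x) =
      Poly_Mapping.lookup \<alpha> c" for c
  proof -
    have "Poly_Mapping.lookup (\<alpha> * Poly_Mapping.single x 1) (c + x) =
        (\<Sum>a\<in>Poly_Mapping.keys \<alpha>. Poly_Mapping.lookup \<alpha> a when c = a)"
      by (simp add: lookup_mult_keys sum.cartesian_product[symmetric])
    then show ?thesis by (simp add: when_def in_keys_iff)
  qed
  have keys_shift: "Poly_Mapping.keys (\<alpha> * Poly_Mapping.single x 1) =
      (\<lambda>c. c + x) ` Poly_Mapping.keys \<alpha>"
  proof (intro equalityI subsetI)
    fix y assume "y \<in> Poly_Mapping.keys (\<alpha> * Poly_Mapping.single x 1)"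
    then show "y \<in> (\<lambda>c. c + x) ` Poly_Mapping.keys \<alpha>" using shift[of "y - x"]
      by (intro image_eqI[where x = "y - x"]) (auto simp: in_keys_iff)
  qed (auto simp: in_keys_iff shift)
  define \<gamma> where "\<gamma> = \<alpha> * Poly_Mapping.single x 1"
  have "Poly_Mapping.lookup (\<gamma> * \<beta>) (a + x + b) =
      (\<Sum>(c, d)\<in>{(a + x, b)}.
        Poly_Mapping.lookup \<gamma> c * Poly_Mapping.lookup \<beta> d when a + x + b = c + d)"
    unfolding lookup_mult_keys
  proof (rule sum.mono_neutral_right)
    show "{(a + x, b)} \<subseteq> Poly_Mapping.keys \<gamma> \<times> Poly_Mapping.keys \<beta>"
      using ab by (simp add: \<gamma>_def keys_shift)
    show "\<forall>p\<in>Poly_Mapping.keys \<gamma> \<times> Poly_Mapping.keys \<beta> - {(a + x, b)}.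
        (case p of (c, d) \<Rightarrow>
          Poly_Mapping.lookup \<gamma> c * Poly_Mapping.lookup \<beta> d when a + x + b = c + d) = 0"
    proof
      fix p assume p: "p \<in> Poly_Mapping.keys \<gamma> \<times> Poly_Mapping.keys \<beta> - {(a + x, b)}"
      then obtain a' b' where p_eq: "p = (a' + x, b')"
        and "a' \<in> Poly_Mapping.keys \<alpha>" "b' \<in> Poly_Mapping.keys \<beta>"
        by (auto simp: \<gamma>_def keys_shift)
      then have "a + x + b \<noteq> a' + x + b'" using uniq[of a' b'] p by auto
      then show "(case p of (c, d) \<Rightarrow>
          Poly_Mapping.lookup \<gamma> c * Poly_Mapping.lookup \<beta> d when a + x + b = c + d) = 0"
        by (simp add: p_eq)
    qed
  qed simp
  also have "\<dots> = Poly_Mapping.lookup \<alpha> a * Poly_Mapping.lookup \<beta> b" by (simp add: shift \<gamma>_def)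
  also have "\<dots> \<noteq> 0" using ab by (simp add: in_keys_iff)
  finally have "\<gamma> * \<beta> \<noteq> 0" by auto
  then show ?thesis by (auto simp: \<gamma>_def)
qed

lemma card_keys_mult_le:
  fixes \<alpha> \<beta> :: "'g::monoid_add \<Rightarrow>\<^sub>0 'f::semiring_0"
  shows "card (Poly_Mapping.keys (\<alpha> * \<beta>)) \<le> card (Poly_Mapping.keys \<alpha>) * card (Poly_Mapping.keys \<beta>)"
proof -
  have "Poly_Mapping.keys (\<alpha> * \<beta>) \<subseteq> (\<lambda>(a, b). a + b) ` (Poly_Mapping.keys \<alpha> \<times> Poly_Mapping.keys \<beta>)"
    using keys_mult[of \<alpha> \<beta>] by auto
  then have "card (Poly_Mapping.keys (\<alpha> * \<beta>)) \<le>
      card ((\<lambda>(a, b). a + b) ` (Poly_Mapping.keys \<alpha> \<times> Poly_Mapping.keys \<beta>))"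
    by (intro card_mono) auto
  also have "\<dots> \<le> card (Poly_Mapping.keys \<alpha> \<times> Poly_Mapping.keys \<beta>)" by (rule card_image_le) simp
  finally show ?thesis by (simp add: card_cartesian_product)
qed

section \<open>From zero divisors to square-zero elements\<close>

theorem proposition1p8:
  fixes k :: nat
  assumes "torsion_free TYPE('g::group_add)"
    and "k > 0"
    and "\<nexists>\<alpha> :: 'g \<Rightarrow>\<^sub>0 'f::field. \<alpha> \<noteq> 0 \<and> card (Poly_Mapping.keys \<alpha>) \<le> k \<and> \<alpha>^2 = 0"
  shows "\<nexists>\<alpha>\<^sub>1 \<alpha>\<^sub>2 :: 'g \<Rightarrow>\<^sub>0 'f. \<alpha>\<^sub>1 \<noteq> 0 \<and> \<alpha>\<^sub>2 \<noteq> 0 \<and> \<alpha>\<^sub>1 * \<alpha>\<^sub>2 = 0 \<and>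
           card (Poly_Mapping.keys \<alpha>\<^sub>1) * card (Poly_Mapping.keys \<alpha>\<^sub>2) \<le> k"
proof (intro notI, elim exE conjE)
  fix \<alpha>\<^sub>1 \<alpha>\<^sub>2 :: "'g \<Rightarrow>\<^sub>0 'f"
  assume nz: "\<alpha>\<^sub>1 \<noteq> 0" "\<alpha>\<^sub>2 \<noteq> 0" and zero: "\<alpha>\<^sub>1 * \<alpha>\<^sub>2 = 0"
    and le: "card (Poly_Mapping.keys \<alpha>\<^sub>1) * card (Poly_Mapping.keys \<alpha>\<^sub>2) \<le> k"
  \<comment> \<open>The factors enter in reversed order, so that squaring brings
    \<open>\<alpha>\<^sub>1 * \<alpha>\<^sub>2\<close> together in the middle.\<close>
  obtain x where x: "\<alpha>\<^sub>2 * Poly_Mapping.single x 1 * \<alpha>\<^sub>1 \<noteq> 0"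
    using group_ring_prime[OF assms(1) nz(2,1)] by blast
  define s :: "'g \<Rightarrow>\<^sub>0 'f" where "s = Poly_Mapping.single x 1"
  have "(\<alpha>\<^sub>2 * s * \<alpha>\<^sub>1)^2 = \<alpha>\<^sub>2 * s * (\<alpha>\<^sub>1 * \<alpha>\<^sub>2) * s * \<alpha>\<^sub>1"
    by (simp add: power2_eq_square mult.assoc)
  then have "(\<alpha>\<^sub>2 * s * \<alpha>\<^sub>1)^2 = 0" by (simp add: zero)
  moreover have "card (Poly_Mapping.keys (\<alpha>\<^sub>2 * s * \<alpha>\<^sub>1)) \<le> k"
  proof -
    \<comment> \<open>The support of \<open>s\<close> is a single element, so multiplying by
      \<open>s\<close> cannot enlarge a support.\<close>
    have "card (Poly_Mapping.keys (\<alpha>\<^sub>2 * s)) \<le> card (Poly_Mapping.keys \<alpha>\<^sub>2)"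
      using card_keys_mult_le[of \<alpha>\<^sub>2 s] by (simp add: s_def)
    then have "card (Poly_Mapping.keys (\<alpha>\<^sub>2 * s)) * card (Poly_Mapping.keys \<alpha>\<^sub>1) \<le>
        card (Poly_Mapping.keys \<alpha>\<^sub>2) * card (Poly_Mapping.keys \<alpha>\<^sub>1)"
      by (rule mult_right_mono) simp
    with card_keys_mult_le[of "\<alpha>\<^sub>2 * s" \<alpha>\<^sub>1] le show ?thesis
      by (metis mult.commute order_trans)
  qed
  ultimately show False using assms(3) x by (auto simp: s_def)
qed

end
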